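(* Let $X$ be a topological lop (with regular underlying space) of countable $\mathrm{cs}^*$-character. If $X$ contains a closed subspace homeomorphic to the metric fan $M_\omega$ and a closed subspace homeomorphic to the Fréchet-Urysohn fan $S_\omega$, then the space $X$ is not sequential.
   Context: All topological spaces are assumed to be regular (including the $T_1$ axiom). A topological lop is a topological space $X$ endowed with a continuous binary operation $X\times X\to X$, $(x,y)\mapsto xy$, which has a two-sided unit $e$ (so $xe=x=ex$ for all $x\in X$) and for which the map $X\times X\to X\times X$, $(x,y)\mapsto(x,xy)$, is a homeomorphism. The operation need not be associative. A family $\mathcal N$ of subsets of $X$ is a $\mathrm{cs}^*$-network at a point $x\in X$ if for each neighborhood $O_x$ of $x$ and each sequence $(x_n)_{n\in\omega}$ in $X$ converging to $x$ there is $N\in\mathcal N$ such that $x\in N\subset O_x$ and $x_n\in N$ for infinitely many $n$. The space $X$ has countable $\mathrm{cs}^*$-character if at each point $x\in X$ it has a countable $\mathrm{cs}^*$-network. A space $X$ is sequential if for each non-closed subset $A\subset X$ there is a sequence in $A$ that converges in $X$ to a point $x\notin A$. The metric fan is the subspace $M_\omega=\{(0,0)\}\cup\{(\frac1n,\frac1{nm}):n,m\in\mathbb N\}$ of the Euclidean plane $\mathbb R^2$, where $\mathbb N=\{1,2,\dots\}$. For $m\in\mathbb N$ let $I_m=\{(0,0)\}\cup\{(\frac1n,\frac1{nm}):n\in\mathbb N\}$. The Fréchet-Urysohn fan $S_\omega$ is the set $\bigcup_{m\in\mathbb N}I_m$ endowed with the strongest topology inducing the Euclidean topology on each $I_m$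 (a set $V$ is open in $S_\omega$ iff $V\cap I_m$ is open in the Euclidean topology of $I_m$ for every $m$). *)

theory Defs
  imports "HOL-Analysis.Analysis"
begin

definition topological_lop :: "'a topology \<Rightarrow> ('a \<Rightarrow> 'a \<Rightarrow> 'a) \<Rightarrow> bool" where
  "topological_lop X mul \<longleftrightarrow>
     continuous_map (prod_topology X X) X (\<lambda>(x, y). mul x y) \<and>
     (\<exists>e\<in>topspace X. \<forall>x\<in>topspace X. mul x e = x \<and> mul e x = x) \<and>
     homeomorphic_map (prod_topology X X) (prod_topology X X) (\<lambda>(x, y). (x, mul x y))"

text \<open>Neighborhoods of a point are not required to be open.\<close>

definition cs_star_network_at :: "'a topology \<Rightarrow> 'a \<Rightarrow> 'a set set \<Rightarrow> bool" where
  "cs_star_network_at X x \<N> \<longleftrightarrow>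
     (\<forall>N\<in>\<N>. N \<subseteq> topspace X) \<and>
     (\<forall>W s. W \<subseteq> topspace X \<and> (\<exists>U. openin X U \<and> x \<in> U \<and> U \<subseteq> W) \<and>
            range s \<subseteq> topspace X \<and> limitin X s x sequentially \<longrightarrow>
            (\<exists>N\<in>\<N>. x \<in> N \<and> N \<subseteq> W \<and> infinite {n::nat. s n \<in> N}))"

definition countable_cs_star_character :: "'a topology \<Rightarrow> bool" where
  "countable_cs_star_character X \<longleftrightarrow>
     (\<forall>x\<in>topspace X. \<exists>\<N>. countable \<N> \<and> cs_star_network_at X x \<N>)"

definition sequential_space :: "'a topology \<Rightarrow> bool" where
  "sequential_space X \<longleftrightarrow>
     (\<forall>A. A \<subseteq> topspace X \<and> \<not> closedin X A \<longrightarrow>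
          (\<exists>(s :: nat \<Rightarrow> 'a) x. range s \<subseteq> A \<and> x \<notin> A \<and> limitin X s x sequentially))"

definition metric_fan :: "(real \<times> real) topology" where
  "metric_fan = top_of_set
     ({(0, 0)} \<union> {(1 / real n, 1 / (real n * real m)) |n m. n \<ge> 1 \<and> m \<ge> 1})"

definition fan_ray :: "nat \<Rightarrow> (real \<times> real) set" where
  "fan_ray m = {(0, 0)} \<union> {(1 / real n, 1 / (real n * real m)) |n. n \<ge> 1}"

definition Frechet_Urysohn_fan :: "(real \<times> real) topology" where
  "Frechet_Urysohn_fan = topology (\<lambda>V. V \<subseteq> (\<Union>m\<in>{1..}. fan_ray m) \<and>
     (\<forall>m\<ge>1. openin (top_of_set (fan_ray m)) (V \<inter> fan_ray m)))"

lemma openin_Frechet_Urysohn_fan: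
  "openin Frechet_Urysohn_fan V \<longleftrightarrow> V \<subseteq> (\<Union>m\<in>{1..}. fan_ray m) \<and>
     (\<forall>m\<ge>1. openin (top_of_set (fan_ray m)) (V \<inter> fan_ray m))"
proof -
  let ?P = "\<lambda>V. V \<subseteq> (\<Union>m\<in>{1..}. fan_ray m) \<and>
     (\<forall>m\<ge>1. openin (top_of_set (fan_ray m)) (V \<inter> fan_ray m))"
  have "istopology ?P"
    unfolding istopology_def
  proof (intro conjI allI impI)
    fix S T m assume "?P S" "?P T" and m: "1 \<le> (m::nat)"
    then have "openin (top_of_set (fan_ray m)) ((S \<inter> fan_ray m) \<inter> (T \<inter> fan_ray m))"
      by blast
    then show "openin (top_of_set (fan_ray m)) (S \<inter> T \<inter> fan_ray m)"
      by (simp add: Int_ac)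
  next
    fix \<K> m assume K: "\<forall>K\<in>\<K>. ?P K" and m: "1 \<le> (m::nat)"
    have "\<Union>\<K> \<inter> fan_ray m = (\<Union>K\<in>\<K>. K \<inter> fan_ray m)" by blast
    then show "openin (top_of_set (fan_ray m)) (\<Union>\<K> \<inter> fan_ray m)"
      using K m by (simp only:) (rule openin_Union, blast)
  qed blast+
  then show ?thesis
    by (simp add: Frechet_Urysohn_fan_def)
qed

lemma topspace_Frechet_Urysohn_fan: "topspace Frechet_Urysohn_fan = (\<Union>m\<in>{1..}. fan_ray m)"
proof
  show "topspace Frechet_Urysohn_fan \<subseteq> (\<Union>m\<in>{1..}. fan_ray m)"
    using openin_Frechet_Urysohn_fan openin_topspace by blast
  have "(\<Union>m\<in>{1..}. fan_ray m) \<inter> fan_ray k = fan_ray k" if "k \<ge> 1" for k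
    using that by auto
  then have "openin Frechet_Urysohn_fan (\<Union>m\<in>{1..}. fan_ray m)"
    by (simp add: openin_Frechet_Urysohn_fan)
  then show "(\<Union>m\<in>{1..}. fan_ray m) \<subseteq> topspace Frechet_Urysohn_fan"
    by (rule openin_subset)
qed

end

theory Submission
  imports Defs
begin

text \<open>Let \<open>a n m\<close> be the points of the metric fan with vertex \<open>p\<close> and \<open>b n k\<close> those of the
  Frechet-Urysohn fan, translated so that its vertex is the unit. The set \<open>C\<close> of all products
  \<open>c n m = a n m * b n (k n m)\<close> with \<open>k n m \<ge> m\<close> accumulates at \<open>p\<close>. If a sequence in \<open>C\<close> with
  \<open>n \<rightarrow> \<infinity>\<close> converged, then \<open>a \<rightarrow> p\<close>, so dividing on the left by \<open>a\<close> would make the factors \<open>b\<close>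
  converge, although they lie on different rays. Right division is not available, so convergence
  inside a single column \<open>n\<close> is excluded by the choice of \<open>k n\<close> instead: countably many sets
  \<open>g * N\<close>, with \<open>g\<close> in the countable set of products and \<open>N\<close> in a cs*-network at the unit, suffice to catch every
  convergent sequence of products, and \<open>k n m\<close> diagonalises against them. Thus \<open>C\<close> is
  sequentially closed but not closed.\<close>

section \<open>Subsequences and limits of sequences\<close>

text \<open>A finite range gives a constant subsequence by pigeonhole. With an infinite range, every
  index is followed by one of larger value, since otherwise the values would be bounded.\<close>

lemma strict_mono_or_constant_subseq:
  fixes f :: "nat \<Rightarrow> nat"
  obtains r :: "nat \<Rightarrow> nat" where "strict_mono r" "strict_mono (f \<circ> r)"
  | r v where "strict_mono (r :: nat \<Rightarrow> nat)" "\<And>j. f (r j) = v"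
proof (cases "finite (range f)")
  case True
  then obtain v where v: "infinite {j. f j = v}"
    using pigeonhole_infinite[of UNIV f] by auto
  have "strict_mono (enumerate {j. f j = v})"
    using v by (simp add: strict_mono_enumerate)
  moreover have "f (enumerate {j. f j = v} j) = v" for j
    using enumerate_in_set[OF v] by auto
  ultimately show ?thesis using that(2) by blast
next
  case False
  have step: "\<exists>j. k < j \<and> f k < f j" for k
  proof (rule ccontr)
    assume "\<not> ?thesis"
    then have "f j \<le> f k" if "j > k" for j
      using that by (meson not_less)
    then have "range f \<subseteq> f ` {..k} \<union> {..f k}"
      by (auto simp: not_less image_iff) (metis atMost_iff not_le)
    then show False using False
      by (meson finite_UnI finite_atMost finite_imageI finite_subset)
  qed
  obtain r where "\<And>i. r i < r (Suc i) \<and> f (r i) < f (r (Suc i))"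
    using dependent_nat_choice[of "\<lambda>_ _. True" "\<lambda>_ x y. x < y \<and> f x < f y"] step
    by blast
  then show ?thesis by (intro that(1)[of r]) (simp_all add: strict_mono_Suc_iff)
qed

lemma limitin_compose_subseq:
  assumes "limitin X s x sequentially" "strict_mono (r :: nat \<Rightarrow> nat)"
  shows "limitin X (\<lambda>j. s (r j)) x sequentially"
  using limitin_subsequence[OF assms(2,1)] by (simp add: o_def)

lemma limitin_const_t1_space:
  assumes "t1_space X" "limitin X (\<lambda>_. c) x F" "F \<noteq> bot" "c \<in> topspace X"
  shows "x = c"
proof (rule ccontr)
  assume "x \<noteq> c"
  then obtain U where U: "openin X U" "x \<in> U" "c \<notin> U"
    using assms(1,4) limitin_topspace[OF assms(2)] unfolding t1_space_def by metis
  with limitinD[OF assms(2) U(1,2)] show False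
    using assms(3) by simp
qed

section \<open>Topological lops\<close>

text \<open>\<open>ldiv x\<close> inverts \<open>mul x\<close>; its joint continuity records that
  the map sending (x, y) to (x, xy) has a continuous inverse.\<close>

locale top_lop =
  fixes X :: "'a topology" and mul ldiv :: "'a \<Rightarrow> 'a \<Rightarrow> 'a" and e :: 'a
  assumes mul_continuous: "continuous_map (prod_topology X X) X (\<lambda>(x, y). mul x y)"
    and ldiv_continuous: "continuous_map (prod_topology X X) X (\<lambda>(x, y). ldiv x y)"
    and e_in [simp]: "e \<in> topspace X"
    and mul_e [simp]: "x \<in> topspace X \<Longrightarrow> mul x e = x"
    and mul_ldiv [simp]: "\<lbrakk>x \<in> topspace X; y \<in> topspace X\<rbrakk> \<Longrightarrow> mul x (ldiv x y) = y"
    and ldiv_mul [simp]: "\<lbrakk>x \<in> topspace X; y \<in> topspace X\<rbrakk> \<Longrightarrow> ldiv x (mul x y) = y"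

lemma topological_lop_imp_top_lop:
  assumes "topological_lop X mul"
  obtains ldiv e where "top_lop X mul ldiv e"
proof -
  let ?P = "prod_topology X X"
  obtain e where cont: "continuous_map ?P X (\<lambda>(x, y). mul x y)"
    and e: "e \<in> topspace X" "\<And>x. x \<in> topspace X \<Longrightarrow> mul x e = x"
    and "homeomorphic_map ?P ?P (\<lambda>(x, y). (x, mul x y))"
    using assms unfolding topological_lop_def by blast
  then obtain g where g: "homeomorphic_maps ?P ?P (\<lambda>(x, y). (x, mul x y)) g"
    using homeomorphic_map_maps by blast
  define ldiv where "ldiv x y = snd (g (x, y))" for x y
  have gcont: "continuous_map ?P ?P g"
    and gl: "\<And>x y. \<lbrakk>x \<in> topspace X; y \<in> topspace X\<rbrakk> \<Longrightarrow> g (x, mul x y) = (x, y)"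
    and gr: "\<And>x y. \<lbrakk>x \<in> topspace X; y \<in> topspace X\<rbrakk> \<Longrightarrow>
               (case g (x, y) of (u, v) \<Rightarrow> (u, mul u v)) = (x, y)"
    using g unfolding homeomorphic_maps_def by force+
  have "continuous_map ?P X (snd \<circ> g)"
    using gcont continuous_map_compose continuous_map_snd by blast
  moreover have "snd \<circ> g = (\<lambda>(x, y). ldiv x y)"
    by (auto simp: ldiv_def)
  moreover have "mul x (ldiv x y) = y" if "x \<in> topspace X" "y \<in> topspace X" for x y
    using gr[OF that] by (auto simp: ldiv_def split: prod.splits)
  ultimately have "top_lop X mul ldiv e"
    using cont e gl by unfold_locales (auto simp: ldiv_def)
  then show ?thesis using that by blast
qed

context top_lop
begin

lemma mul_closed [simp]: "\<lbrakk>x \<in> topspace X; y \<in> topspace X\<rbrakk> \<Longrightarrow> mul x y \<in> topspace X"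
  using mul_continuous unfolding continuous_map_def by (auto simp: Pi_iff)

lemma ldiv_closed [simp]: "\<lbrakk>x \<in> topspace X; y \<in> topspace X\<rbrakk> \<Longrightarrow> ldiv x y \<in> topspace X"
  using ldiv_continuous unfolding continuous_map_def by (auto simp: Pi_iff)

lemma ldiv_self [simp]: "x \<in> topspace X \<Longrightarrow> ldiv x x = e"
  using ldiv_mul[of x e] by simp

lemma limitin_mul:
  assumes "limitin X u x F" "limitin X v y F"
  shows "limitin X (\<lambda>i. mul (u i) (v i)) (mul x y) F"
  using continuous_map_limit[OF mul_continuous, of "\<lambda>i. (u i, v i)" "(x, y)"] assms
  by (simp add: limitin_pairwise o_def)

lemma limitin_ldiv:
  assumes "limitin X u x F" "limitin X v y F"
  shows "limitin X (\<lambda>i. ldiv (u i) (v i)) (ldiv x y) F"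
  using continuous_map_limit[OF ldiv_continuous, of "\<lambda>i. (u i, v i)" "(x, y)"] assms
  by (simp add: limitin_pairwise o_def)

lemma mul_neighbourhoods:
  assumes "openin X W" "mul x y \<in> W" "x \<in> topspace X" "y \<in> topspace X"
  obtains U V where "openin X U" "openin X V" "x \<in> U" "y \<in> V"
    "\<And>u v. \<lbrakk>u \<in> U; v \<in> V\<rbrakk> \<Longrightarrow> mul u v \<in> W"
proof -
  define Q where "Q = {z \<in> topspace (prod_topology X X). (\<lambda>(x, y). mul x y) z \<in> W}"
  have "openin (prod_topology X X) Q"
    unfolding Q_def using mul_continuous assms(1) by (rule openin_continuous_map_preimage)
  moreover have "(x, y) \<in> Q" using assms by (simp add: Q_def)
  ultimately have "\<exists>U V. openin X U \<and> openin X V \<and> x \<in> U \<and> y \<in> V \<and> U \<times> V \<subseteq> Q"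
    by (simp add: openin_prod_topology_alt)
  then obtain U V where UV: "openin X U" "openin X V" "x \<in> U" "y \<in> V" "U \<times> V \<subseteq> Q"
    by (elim exE conjE)
  show ?thesis using UV(5) by (intro that[OF UV(1-4)]) (auto simp: Q_def)
qed

text \<open>Applying the network to \<open>ldiv (y i) (y j)\<close>, which tends to \<open>e\<close> as both indices grow,
  instead of \<open>ldiv x (y j)\<close> keeps the family of translates countable when the sequences range
  over a countable set: their limits \<open>x\<close> may be uncountably many.\<close>

lemma translated_network_catches_sequence:
  assumes \<N>: "countable \<N>" "cs_star_network_at X e \<N>"
    and y: "range y \<subseteq> topspace X" "limitin X y x sequentially"
    and W: "openin X W" "x \<in> W"
  obtains i N where "N \<in> \<N>" "mul (y i) ` N \<subseteq> W" "infinite {j. y j \<in> mul (y i) ` N}"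
proof (rule ccontr)
  assume "\<not> thesis"
  then have fin: "finite {j. y j \<in> mul (y i) ` N}" if "N \<in> \<N>" "mul (y i) ` N \<subseteq> W" for i N
    using \<open>\<And>N i. \<lbrakk>N \<in> \<N>; mul (y i) ` N \<subseteq> W; infinite {j. y j \<in> mul (y i) ` N}\<rbrakk> \<Longrightarrow> thesis\<close> that
    by blast
  have x: "x \<in> topspace X" using y(2) by (rule limitin_topspace)
  have yX: "y i \<in> topspace X" for i using y(1) by blast
  \<comment> \<open>\<open>mul x e = x\<close> lies in \<open>W\<close>, so once \<open>y i\<close>
    is in \<open>V\<close>, its translate of a network member inside \<open>U\<close> lies in
    \<open>W\<close> and, by assumption, catches only finitely many terms.\<close>
  obtain V U where VU: "openin X V" "openin X U" "x \<in> V" "e \<in> U"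
    "\<And>u v. \<lbrakk>u \<in> V; v \<in> U\<rbrakk> \<Longrightarrow> mul u v \<in> W"
    using mul_neighbourhoods[OF W(1), of x e] W(2) x by auto
  obtain i0 where i0: "\<And>i. i \<ge> i0 \<Longrightarrow> y i \<in> V"
    using limitinD[OF y(2) VU(1,3)] by (auto simp: eventually_sequentially)
  \<comment> \<open>The empty set makes the enumerated family nonempty; its translates catch
    nothing.\<close>
  define \<M> where "\<M> = insert {} {N \<in> \<N>. N \<subseteq> U}"
  define M where "M = from_nat_into \<M>"
  have "countable \<M>" "\<M> \<noteq> {}" using \<N>(1) by (auto simp: \<M>_def)
  then have rangeM: "range M = \<M>" unfolding M_def by (rule range_from_nat_into[rotated])
  have finM: "finite {j. y j \<in> mul (y i) ` M l}" if "i \<ge> i0" for i l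
  proof (cases "M l = {}")
    case False
    then have "M l \<in> \<N>" "M l \<subseteq> U" using rangeM unfolding \<M>_def by auto
    then show ?thesis using VU(5) i0[OF that] by (intro fin) auto
  qed simp
  \<comment> \<open>Diagonal choice: the members of the enumeration up to index \<open>i\<close>,
    translated by \<open>y i\<close>, contain only finitely many terms, so some later term avoids
    them all.\<close>
  have "\<exists>j\<ge>i. \<forall>l\<le>i. y j \<notin> mul (y i) ` M l" if "i \<ge> i0" for i
  proof -
    have "finite ({..i} \<union> (\<Union>l\<le>i. {j. y j \<in> mul (y i) ` M l}))"
      using finM[OF that] by auto
    then obtain j where "j \<notin> {..i} \<union> (\<Union>l\<le>i. {j. y j \<in> mul (y i) ` M l})"
      using ex_new_if_finite infinite_UNIV_nat by blast
    then show ?thesis by (intro exI[of _ j]) auto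
  qed
  then obtain J where J: "\<And>i. i \<ge> i0 \<Longrightarrow> J i \<ge> i"
    "\<And>i l. \<lbrakk>i \<ge> i0; l \<le> i\<rbrakk> \<Longrightarrow> y (J i) \<notin> mul (y i) ` M l" by metis
  \<comment> \<open>Both indices grow, so \<open>t\<close> tends to \<open>ldiv x x = e\<close>. The
    shift by \<open>i0\<close> keeps every translating term in \<open>V\<close>.\<close>
  define t where "t i = ldiv (y (i + i0)) (y (J (i + i0)))" for i
  have "filterlim (\<lambda>i. J (i + i0)) at_top sequentially"
  proof (rule filterlim_at_top_mono[OF filterlim_ident])
    show "\<forall>\<^sub>F i in sequentially. i \<le> J (i + i0)"
      using J(1) by (intro always_eventually allI) (metis add_leD1 le_add2)
  qed
  then have "limitin X (\<lambda>i. y (J (i + i0))) x sequentially"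
    using y(2) unfolding limitin_def filterlim_iff by blast
  then have "limitin X t e sequentially"
    using limitin_ldiv[OF limitin_sequentially_offset[OF y(2), of i0]] x
    unfolding t_def by fastforce
  moreover have "range t \<subseteq> topspace X" using yX by (auto simp: t_def)
  ultimately obtain N where N: "N \<in> \<N>" "N \<subseteq> U" "infinite {i. t i \<in> N}"
    using \<N>(2) VU(2,4) openin_subset[OF VU(2)] unfolding cs_star_network_at_def
    by (metis order_refl)
  then obtain l where l: "M l = N" using rangeM unfolding \<M>_def by (metis (mono_tags, lifting) imageE insertI2 mem_Collect_eq)
  \<comment> \<open>Infinitely many terms of \<open>t\<close> lie in \<open>N\<close>, so one has
    index at least the position \<open>l\<close> of \<open>N\<close>; multiplying it back
    contradicts the choice of \<open>J\<close>.\<close>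
  obtain i where i: "i \<ge> l" "t i \<in> N"
    using N(3) unfolding infinite_nat_iff_unbounded_le by blast
  then have "mul (y (i + i0)) (t i) \<in> mul (y (i + i0)) ` M l" using l by blast
  then have "y (J (i + i0)) \<in> mul (y (i + i0)) ` M l" using yX by (simp add: t_def)
  then show False using J(2)[of "i + i0" l] i(1) by simp
qed

section \<open>Perturbing one column of the metric fan\<close>

text \<open>As \<open>k\<close> grows, \<open>mul (\<alpha> m) (\<beta> k)\<close> tends to
  \<open>\<alpha> m\<close>, so \<open>k m\<close> can be chosen to avoid finitely many sets whose
  closures miss \<open>\<alpha> m\<close>. Local finiteness of \<open>\<alpha>\<close> and
  regularity ensure that a set catching a convergent subsequence would be among those avoided from
  some stage on.\<close>

lemma perturbed_column_without_limits:
  assumes "regular_space X" "t1_space X"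
    and \<N>: "countable \<N>" "cs_star_network_at X e \<N>"
    and \<alpha>: "range \<alpha> \<subseteq> topspace X" "\<And>m. \<alpha> m \<noteq> p" "p \<in> topspace X"
    and loc_fin: "\<And>x. x \<in> topspace X \<Longrightarrow> \<exists>U. openin X U \<and> x \<in> U \<and> finite {m::nat. \<alpha> m \<in> U}"
    and \<beta>: "range \<beta> \<subseteq> topspace X" "limitin X \<beta> e sequentially"
  obtains k where "\<And>m. k m \<ge> m" "\<And>m. mul (\<alpha> m) (\<beta> (k m)) \<noteq> p"
    "\<And>r x. strict_mono r \<Longrightarrow> \<not> limitin X (\<lambda>j. mul (\<alpha> (r j)) (\<beta> (k (r j)))) x sequentially"
proof -
  have \<alpha>X: "\<alpha> m \<in> topspace X" and \<beta>X: "\<beta> m \<in> topspace X" for m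
    using \<alpha>(1) \<beta>(1) by auto
  define \<F> where "\<F> = insert {} {F. finite {m. \<alpha> m \<in> X closure_of F} \<and>
    F \<in> (\<lambda>(m, k, N). mul (mul (\<alpha> m) (\<beta> k)) ` N) ` (UNIV \<times> UNIV \<times> \<N>)}"
  have "countable ((\<lambda>(m, k, N). mul (mul (\<alpha> m) (\<beta> k)) ` N) ` (UNIV \<times> UNIV \<times> \<N>))"
    using \<N>(1) by (intro countable_image countable_SIGMA) auto
  then have "countable {F. finite {m. \<alpha> m \<in> X closure_of F} \<and>
      F \<in> (\<lambda>(m, k, N). mul (mul (\<alpha> m) (\<beta> k)) ` N) ` (UNIV \<times> UNIV \<times> \<N>)}"
    by (rule countable_subset[rotated]) blast
  then have "countable \<F>" "\<F> \<noteq> {}" unfolding \<F>_def by blast+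
  define F where "F = from_nat_into \<F>"
  have rangeF: "range F = \<F>"
    unfolding F_def using \<open>countable \<F>\<close> \<open>\<F> \<noteq> {}\<close> by (rule range_from_nat_into[rotated])
  have finF: "finite {m. \<alpha> m \<in> X closure_of (F l)}" for l
  proof -
    have "F l \<in> \<F>" using rangeF by blast
    then show ?thesis unfolding \<F>_def by auto
  qed
  have "\<exists>k\<ge>m. mul (\<alpha> m) (\<beta> k) \<noteq> p \<and>
          (\<forall>l\<le>m. \<alpha> m \<notin> X closure_of (F l) \<longrightarrow> mul (\<alpha> m) (\<beta> k) \<notin> F l)" for m
  proof -
    have lim: "limitin X (\<lambda>k. mul (\<alpha> m) (\<beta> k)) (\<alpha> m) sequentially"
      using limitin_mul[OF _ \<beta>(2), of "\<lambda>_. \<alpha> m" "\<alpha> m"] \<alpha>X by simp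
    obtain U where U: "openin X U" "\<alpha> m \<in> U" "p \<notin> U"
      using \<open>t1_space X\<close> \<alpha>(2,3) \<alpha>X unfolding t1_space_def by metis
    have "\<forall>\<^sub>F k in sequentially. mul (\<alpha> m) (\<beta> k) \<noteq> p"
      using limitinD[OF lim U(1,2)] by eventually_elim (use U(3) in blast)
    moreover have "\<forall>\<^sub>F k in sequentially. \<alpha> m \<notin> X closure_of (F l) \<longrightarrow> mul (\<alpha> m) (\<beta> k) \<notin> F l"
      for l
    proof (cases "\<alpha> m \<in> X closure_of (F l)")
      case False
      then obtain T where T: "openin X T" "\<alpha> m \<in> T" "T \<inter> F l = {}"
        using \<alpha>X by (auto simp: in_closure_of)
      show ?thesis using limitinD[OF lim T(1,2)] by eventually_elim (use T(3) in blast)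
    qed simp
    \<comment> \<open>Stage \<open>m\<close> treats only the sets \<open>F l\<close> with
      \<open>l \<le> m\<close>, so finitely many eventual conditions are met at once.\<close>
    then have "\<forall>\<^sub>F k in sequentially.
        \<forall>l\<in>{..m}. \<alpha> m \<notin> X closure_of (F l) \<longrightarrow> mul (\<alpha> m) (\<beta> k) \<notin> F l"
      by (intro eventually_ball_finite) auto
    ultimately have "\<forall>\<^sub>F k in sequentially. k \<ge> m \<and> mul (\<alpha> m) (\<beta> k) \<noteq> p \<and>
        (\<forall>l\<in>{..m}. \<alpha> m \<notin> X closure_of (F l) \<longrightarrow> mul (\<alpha> m) (\<beta> k) \<notin> F l)"
      by (intro eventually_conj eventually_ge_at_top)
    then show ?thesis unfolding eventually_sequentially by (metis atMost_iff order_refl)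
  qed
  then obtain k where k: "\<And>m. k m \<ge> m" "\<And>m. mul (\<alpha> m) (\<beta> (k m)) \<noteq> p"
    "\<And>m l. \<lbrakk>l \<le> m; \<alpha> m \<notin> X closure_of (F l)\<rbrakk> \<Longrightarrow> mul (\<alpha> m) (\<beta> (k m)) \<notin> F l"
    by metis
  have "\<not> limitin X (\<lambda>j. mul (\<alpha> (r j)) (\<beta> (k (r j)))) x sequentially" if r: "strict_mono r" for r x
  proof
    let ?y = "\<lambda>j. mul (\<alpha> (r j)) (\<beta> (k (r j)))"
    assume lim: "limitin X ?y x sequentially"
    then have "x \<in> topspace X" by (rule limitin_topspace)
    then obtain U where U: "openin X U" "x \<in> U" "finite {m. \<alpha> m \<in> U}"
      using loc_fin by blast
    then obtain W Z where W: "openin X W" "closedin X Z" "x \<in> W" "W \<subseteq> Z" "Z \<subseteq> U"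
      using \<open>regular_space X\<close> unfolding neighbourhood_base_of_closedin[symmetric] neighbourhood_base_of
      by metis
    have "range ?y \<subseteq> topspace X" using \<alpha>X \<beta>X by auto
    then obtain i N where iN: "N \<in> \<N>" "mul (?y i) ` N \<subseteq> W" "infinite {j. ?y j \<in> mul (?y i) ` N}"
      using lim W(1,3) by (rule translated_network_catches_sequence[OF \<N>])
    \<comment> \<open>The closed set \<open>Z\<close> between \<open>W\<close> and \<open>U\<close>
      bounds the closure of the translate, which therefore belongs to \<open>\<F>\<close>.\<close>
    have "X closure_of (mul (?y i) ` N) \<subseteq> U"
      using iN(2) W by (meson closure_of_minimal order_trans)
    then have "finite {m. \<alpha> m \<in> X closure_of (mul (?y i) ` N)}"
      by (intro finite_subset[OF _ U(3)]) auto
    then have "mul (?y i) ` N \<in> \<F>"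
      using iN(1) unfolding \<F>_def by (auto simp: image_iff)
    then obtain l where l: "F l = mul (?y i) ` N" using rangeF by (metis imageE)
    have "finite (r -` ({..l} \<union> {m. \<alpha> m \<in> X closure_of (F l)}))"
      using finF r by (intro finite_vimageI strict_mono_imp_inj_on) auto
    moreover have "{j. ?y j \<in> F l} \<subseteq> r -` ({..l} \<union> {m. \<alpha> m \<in> X closure_of (F l)})"
      using k(3)[of l] by auto (meson linear)
    ultimately show False using iN(3) l by (metis finite_subset)
  qed
  then show ?thesis using that k(1,2) by blast
qed

section \<open>From double sequences to failure of sequentiality\<close>

text \<open>Separates the lop argument from the geometry: \<open>a n\<close> stands for a column of
  the metric fan with vertex \<open>p\<close>, \<open>b n\<close> for a ray of the Frechet-Urysohn
  fan with vertex \<open>q\<close>.\<close>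

lemma not_sequential_if_double_sequences:
  fixes a b :: "nat \<Rightarrow> nat \<Rightarrow> 'a"
  assumes "regular_space X" "t1_space X"
    and \<N>: "countable \<N>" "cs_star_network_at X e \<N>"
    and p: "p \<in> topspace X" and q: "q \<in> topspace X"
    and aX: "\<And>n m. a n m \<in> topspace X" and bX: "\<And>n k. b n k \<in> topspace X"
    and a_ne: "\<And>n m. a n m \<noteq> p"
    and a_lim: "\<And>U. \<lbrakk>openin X U; p \<in> U\<rbrakk> \<Longrightarrow> \<exists>n0. \<forall>n\<ge>n0. \<forall>m. a n m \<in> U"
    and a_loc_fin: "\<And>n x. x \<in> topspace X \<Longrightarrow> \<exists>U. openin X U \<and> x \<in> U \<and> finite {m. a n m \<in> U}"
    and b_lim: "\<And>n. limitin X (b n) q sequentially"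
    and b_no_lim: "\<And>r \<kappa> x. strict_mono r \<Longrightarrow> \<not> limitin X (\<lambda>j. b (r j) (\<kappa> j)) x sequentially"
  shows "\<not> sequential_space X"
proof
  assume seq: "sequential_space X"
  \<comment> \<open>Left division by \<open>q\<close> moves the vertex to \<open>e\<close>;
    multiplication by \<open>q\<close> undoes it, so divergence across rays survives.\<close>
  define b' where "b' n k = ldiv q (b n k)" for n k
  have b'X: "b' n k \<in> topspace X" for n k using q bX by (simp add: b'_def)
  have b'_lim: "limitin X (b' n) e sequentially" for n
    using limitin_ldiv[OF _ b_lim, of "\<lambda>_. q" q] q unfolding b'_def by simp
  have b'_no_lim: "\<not> limitin X (\<lambda>j. b' (r j) (\<kappa> j)) x sequentially" if "strict_mono r" for r \<kappa> x
  proof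
    assume "limitin X (\<lambda>j. b' (r j) (\<kappa> j)) x sequentially"
    then have "limitin X (\<lambda>j. mul q (b' (r j) (\<kappa> j))) (mul q x) sequentially"
      using limitin_mul[of "\<lambda>_. q" q] q by simp
    then show False using b_no_lim[OF that] q bX by (simp add: b'_def)
  qed
  have "\<exists>k. (\<forall>m. k m \<ge> m) \<and> (\<forall>m. mul (a n m) (b' n (k m)) \<noteq> p) \<and>
    (\<forall>r x. strict_mono r \<longrightarrow> \<not> limitin X (\<lambda>j. mul (a n (r j)) (b' n (k (r j)))) x sequentially)" for n
  proof -
    have "range (a n) \<subseteq> topspace X" "range (b' n) \<subseteq> topspace X" using aX b'X by auto
    then obtain k where "\<And>m. k m \<ge> m" "\<And>m. mul (a n m) (b' n (k m)) \<noteq> p"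
      "\<And>r x. strict_mono r \<Longrightarrow> \<not> limitin X (\<lambda>j. mul (a n (r j)) (b' n (k (r j)))) x sequentially"
      using perturbed_column_without_limits[OF assms(1,2) \<N> _ a_ne p a_loc_fin _ b'_lim] by metis
    then show ?thesis by (intro exI[of _ k] conjI allI impI)
  qed
  then obtain k where k: "\<And>n m. k n m \<ge> m" "\<And>n m. mul (a n m) (b' n (k n m)) \<noteq> p"
    "\<And>n r x. strict_mono r \<Longrightarrow>
       \<not> limitin X (\<lambda>j. mul (a n (r j)) (b' n (k n (r j)))) x sequentially"
    by metis
  define c where "c n m = mul (a n m) (b' n (k n m))" for n m
  define C where "C = range (\<lambda>(n, m). c n m)"
  have cX: "c n m \<in> topspace X" for n m using aX b'X by (simp add: c_def)
  have "p \<notin> C" using k(2) by (auto simp: C_def c_def)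
  \<comment> \<open>A neighbourhood of \<open>p = mul p e\<close> contains a product of
    neighbourhoods of \<open>p\<close> and \<open>e\<close>. The first contains a whole column
    \<open>a n\<close>, the second contains \<open>b' n (k n m)\<close> for large \<open>m\<close>
    because \<open>k n m \<ge> m\<close>.\<close>
  have "\<not> closedin X C"
  proof
    assume "closedin X C"
    then have "openin X (topspace X - C)" by blast
    then obtain U V where UV: "openin X U" "openin X V" "p \<in> U" "e \<in> V"
      "\<And>u v. \<lbrakk>u \<in> U; v \<in> V\<rbrakk> \<Longrightarrow> mul u v \<in> topspace X - C"
      using mul_neighbourhoods[of "topspace X - C" p e] p \<open>p \<notin> C\<close> by (auto; metis)
    obtain n where n: "\<And>m. a n m \<in> U" using a_lim[OF UV(1,3)] by blast
    obtain m where "\<And>k. k \<ge> m \<Longrightarrow> b' n k \<in> V"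
      using limitinD[OF b'_lim UV(2,4)] by (auto simp: eventually_sequentially)
    then have "c n m \<notin> C" using UV(5) n k(1) by (simp add: c_def)
    then show False by (auto simp: C_def)
  qed
  moreover have "C \<subseteq> topspace X" using cX by (auto simp: C_def)
  ultimately obtain s x where s: "range s \<subseteq> C" "x \<notin> C" "limitin X s x sequentially"
    using seq unfolding sequential_space_def by metis
  have "s j \<in> C" for j using s(1) by blast
  then have "\<forall>j. \<exists>n m. s j = c n m" by (auto simp: C_def image_iff)
  then obtain \<nu> \<mu> where sc: "\<And>j. s j = c (\<nu> j) (\<mu> j)" by metis
  show False
  proof (cases rule: strict_mono_or_constant_subseq[of \<nu>])
    case (1 r)
    have "limitin X (\<lambda>j. a (\<nu> (r j)) (\<mu> (r j))) p sequentially"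
      unfolding limitin_def
    proof (intro conjI allI impI)
      fix U assume "openin X U \<and> p \<in> U"
      then obtain n0 where n0: "\<And>n m. n \<ge> n0 \<Longrightarrow> a n m \<in> U" using a_lim by metis
      have "\<nu> (r j) \<ge> n0" if "j \<ge> n0" for j
        using strict_mono_imp_increasing[OF 1(2), of j] that by simp
      then show "\<forall>\<^sub>F j in sequentially. a (\<nu> (r j)) (\<mu> (r j)) \<in> U"
        using n0 unfolding eventually_sequentially by blast
    qed (rule p)
    then have "limitin X (\<lambda>j. ldiv (a (\<nu> (r j)) (\<mu> (r j))) (s (r j))) (ldiv p x) sequentially"
      using limitin_compose_subseq[OF s(3) 1(1)] by (rule limitin_ldiv)
    then have "limitin X (\<lambda>j. b' (\<nu> (r j)) (k (\<nu> (r j)) (\<mu> (r j)))) (ldiv p x) sequentially"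
      using aX b'X by (simp add: sc c_def)
    then show False
      using b'_no_lim[OF 1(2), of "\<lambda>j. k (\<nu> (r j)) (\<mu> (r j))"] by simp
  next
    \<comment> \<open>In a fixed column, increasing inner indices are excluded by the choice of
      \<open>k\<close>, and a constant inner index would put the limit in \<open>C\<close>.\<close>
    case (2 r n)
    have lim: "limitin X (\<lambda>j. c n (\<mu> (r j))) x sequentially"
      using limitin_compose_subseq[OF s(3) 2(1)] 2(2) by (simp add: sc)
    show False
    proof (cases rule: strict_mono_or_constant_subseq[of "\<mu> \<circ> r"])
      case (1 r')
      then show False
        using k(3)[of "(\<mu> \<circ> r) \<circ> r'" n x] limitin_compose_subseq[OF lim, of r'] by (simp add: c_def)
    next
      case (2 r' m)
      then have "limitin X (\<lambda>_::nat. c n m) x sequentially"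
        using limitin_compose_subseq[OF lim, of r'] by simp
      then have "x = c n m"
        using limitin_const_t1_space[OF \<open>t1_space X\<close>] cX by (metis sequentially_bot)
      then show False using s(2) by (auto simp: C_def)
    qed
  qed
qed

end

section \<open>Double sequences in the fans\<close>

text \<open>A column lies on one vertical line and accumulates in the plane only on the horizontal
  axis, outside the fan, so it is locally finite in the fan; closedness of \<open>A\<close> extends
  this to \<open>X\<close>.\<close>

lemma closed_metric_fan_double_sequence:
  assumes A: "closedin X A" "subtopology X A homeomorphic_space metric_fan"
  obtains p and a :: "nat \<Rightarrow> nat \<Rightarrow> 'a" where "p \<in> topspace X" "\<And>n m. a n m \<in> topspace X"
    "\<And>n m. a n m \<noteq> p"
    "\<And>U. \<lbrakk>openin X U; p \<in> U\<rbrakk> \<Longrightarrow> \<exists>n0. \<forall>n\<ge>n0. \<forall>m. a n m \<in> U"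
    "\<And>n x. x \<in> topspace X \<Longrightarrow> \<exists>U. openin X U \<and> x \<in> U \<and> finite {m. a n m \<in> U}"
proof -
  define z where "z n m = (1 / real (Suc n), 1 / (real (Suc n) * real (Suc m)))" for n m
  define M where "M = {(0 :: real, 0 :: real)} \<union> {(1 / real n, 1 / (real n * real m)) |n m. n \<ge> 1 \<and> m \<ge> 1}"
  have fan: "metric_fan = top_of_set M" by (simp add: metric_fan_def M_def)
  have zM: "z n m \<in> M" for n m
    unfolding M_def z_def by (metis (mono_tags, lifting) UnI2 le_add1 mem_Collect_eq plus_1_eq_Suc)
  have zero: "(0, 0) \<in> M" by (simp add: M_def)
  have z0: "z n m \<noteq> (0, 0)" for n m by (simp add: z_def)
  obtain f g where fg: "homeomorphic_maps (top_of_set M) (subtopology X A) f g"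
    using A(2) homeomorphic_space_sym unfolding fan homeomorphic_space_def by blast
  have f: "continuous_map (top_of_set M) (subtopology X A) f"
    and g: "continuous_map (subtopology X A) (top_of_set M) g"
    and gf: "\<And>u. u \<in> M \<Longrightarrow> g (f u) = u"
    and fgx: "\<And>x. \<lbrakk>x \<in> topspace X; x \<in> A\<rbrakk> \<Longrightarrow> f (g x) = x"
    using fg unfolding homeomorphic_maps_def by auto
  have fX: "f u \<in> topspace X" "f u \<in> A" if "u \<in> M" for u
    using continuous_map_image_subset_topspace[OF f] that by auto
  have gM: "g x \<in> M" if "x \<in> topspace X" "x \<in> A" for x
    using continuous_map_image_subset_topspace[OF g] that by auto
  show ?thesis
  proof (rule that[of "f (0, 0)" "\<lambda>n m. f (z n m)"])
    show "f (0, 0) \<in> topspace X" "f (z n m) \<in> topspace X" for n m using fX zM zero by auto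
    show "f (z n m) \<noteq> f (0, 0)" for n m using gf zM zero z0 by metis
  next
    fix U assume U: "openin X U" "f (0, 0) \<in> U"
    have "openin (top_of_set M) {u \<in> M. f u \<in> U}"
      using openin_continuous_map_preimage[OF continuous_map_into_fulltopology[OF f] U(1)] by simp
    then obtain T where T: "open T" "{u \<in> M. f u \<in> U} = M \<inter> T"
      unfolding openin_open by blast
    then have "(0, 0) \<in> T" using U(2) zero by blast
    then obtain \<epsilon> where "\<epsilon> > 0" "\<And>u. dist u (0, 0) < \<epsilon> \<Longrightarrow> u \<in> T"
      using T(1) unfolding open_dist by blast
    then have \<epsilon>: "\<epsilon> > 0" "\<And>u. \<lbrakk>u \<in> M; dist u (0, 0) < \<epsilon>\<rbrakk> \<Longrightarrow> f u \<in> U"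
      using T(2) by blast+
    \<comment> \<open>Both coordinates of \<open>z n m\<close> are at most
      \<open>1 / real (Suc n)\<close>, so \<open>\<epsilon> / 2\<close> for each gives an
      \<open>n0\<close> independent of \<open>m\<close>.\<close>
    obtain n0 where n0: "n0 > 0" "1 / real n0 < \<epsilon> / 2"
      using \<epsilon>(1) by (metis ex_inverse_of_nat_less half_gt_zero inverse_eq_divide)
    have "f (z n m) \<in> U" if "n \<ge> n0" for n m
    proof (rule \<epsilon>(2)[OF zM])
      have 1: "1 / real (Suc n) < \<epsilon> / 2"
        using n0 that by (smt (verit) frac_le of_nat_0_less_iff of_nat_mono le_Suc_eq)
      have "real (Suc n) * 1 \<le> real (Suc n) * real (Suc m)"
        by (intro mult_left_mono) auto
      then have 2: "1 / (real (Suc n) * real (Suc m)) \<le> 1 / real (Suc n)"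
        by (intro divide_left_mono) auto
      have "dist (z n m) (0, 0) \<le> \<bar>1 / real (Suc n)\<bar> + \<bar>1 / (real (Suc n) * real (Suc m))\<bar>"
        using sqrt_sum_squares_le_sum_abs[of "1 / real (Suc n)" "1 / (real (Suc n) * real (Suc m))"]
        unfolding z_def dist_Pair_Pair dist_real_def diff_0_right power2_abs .
      also have "\<dots> < \<epsilon>" using 1 2 by (simp add: abs_of_nonneg del: of_nat_Suc)
      finally show "dist (z n m) (0, 0) < \<epsilon>" .
    qed
    then show "\<exists>n0. \<forall>n\<ge>n0. \<forall>m. f (z n m) \<in> U" by blast
  next
    fix n x assume x: "x \<in> topspace X"
    show "\<exists>U. openin X U \<and> x \<in> U \<and> finite {m. f (z n m) \<in> U}"
    proof (cases "x \<in> A")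
      case False
      then show ?thesis using A(1) x fX zM by (intro exI[of _ "topspace X - A"]) auto
    next
      case True
      \<comment> \<open>A vertical line separates the vertex from the column. Any other fan point
        has positive height, and above a positive height the column has finitely many
        points.\<close>
      have "\<exists>T. open T \<and> g x \<in> T \<and> finite {m. z n m \<in> T}"
      proof (cases "g x = (0, 0)")
        case True
        have "open ({..<1 / real (Suc n)} \<times> (UNIV :: real set))" by (intro open_Times) auto
        then show ?thesis using True by (intro exI conjI) (auto simp: z_def)
      next
        case False
        then have "snd (g x) > 0" using gM[OF x True] by (auto simp: M_def)
        then obtain c where c: "0 < c" "c < snd (g x)" using dense by blast
        have fin: "finite {m. z n m \<in> UNIV \<times> {c<..}}"
        proof -
          obtain m0 where m0: "m0 > 0" "1 / real m0 < c"
            using c(1) by (metis ex_inverse_of_nat_less inverse_eq_divide)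
          have "m < m0" if "1 / (real (Suc n) * real (Suc m)) > c" for m
          proof (rule ccontr)
            assume "\<not> m < m0"
            then have "m0 \<le> Suc n * Suc m" by simp
            then have "real m0 \<le> real (Suc n) * real (Suc m)"
              by (metis of_nat_le_iff of_nat_mult)
            then have "1 / (real (Suc n) * real (Suc m)) \<le> 1 / real m0"
              using m0(1) by (intro divide_left_mono) auto
            then show False using m0(2) that by linarith
          qed
          then show ?thesis by (intro finite_subset[OF _ finite_lessThan[of m0]]) (auto simp: z_def)
        qed
        have "open ((UNIV :: real set) \<times> {c<..})" by (intro open_Times) auto
        then show ?thesis using fin c(2) by (intro exI conjI) (auto simp: mem_Times_iff)
      qed
      then obtain T where T: "open T" "g x \<in> T" "finite {m. z n m \<in> T}" by blast
      \<comment> \<open>Only the trace of \<open>U\<close> on \<open>A\<close> is controlled, which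
        suffices because every \<open>f (z n m)\<close> lies in \<open>A\<close>.\<close>
      have "openin (subtopology X A) {y \<in> topspace (subtopology X A). g y \<in> T}"
        using openin_continuous_map_preimage[OF continuous_map_into_fulltopology[OF g]] T(1) by simp
      then obtain U where U: "openin X U" "{y \<in> topspace (subtopology X A). g y \<in> T} = U \<inter> A"
        unfolding openin_subtopology by blast
      have "x \<in> U" using U(2) T(2) x True by auto
      moreover have "{m. f (z n m) \<in> U} \<subseteq> {m. z n m \<in> T}"
      proof clarify
        fix m assume "f (z n m) \<in> U"
        then have "f (z n m) \<in> {y \<in> topspace (subtopology X A). g y \<in> T}"
          using fX(2)[OF zM] U(2) by blast
        then show "z n m \<in> T" using gf[OF zM] by simp
      qed
      ultimately show ?thesis using U(1) T(3) finite_subset by blast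
    qed
  qed
qed

text \<open>A set meeting every ray in finitely many points is closed in the fan. A sequence
  visiting each ray at most once could thus converge only by being eventually constant, which
  distinct rays forbid.\<close>

lemma closed_Frechet_Urysohn_fan_double_sequence:
  assumes B: "closedin X B" "subtopology X B homeomorphic_space Frechet_Urysohn_fan"
  obtains q and b :: "nat \<Rightarrow> nat \<Rightarrow> 'a" where "q \<in> topspace X" "\<And>n k. b n k \<in> topspace X"
    "\<And>n. limitin X (b n) q sequentially"
    "\<And>r \<kappa> x. strict_mono r \<Longrightarrow> \<not> limitin X (\<lambda>j. b (r j) (\<kappa> j)) x sequentially"
proof -
  let ?S = Frechet_Urysohn_fan
  \<comment> \<open>Here the first index names the ray \<open>fan_ray (Suc n)\<close> and the second
    the position on it, the reverse of the metric fan above.\<close>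
  define z where "z n k = (1 / real (Suc k), 1 / (real (Suc k) * real (Suc n)))" for n k
  have z_ray: "z n k \<in> fan_ray (Suc n)" for n k
    unfolding fan_ray_def z_def by (metis (mono_tags, lifting) UnI2 le_add1 mem_Collect_eq plus_1_eq_Suc)
  \<comment> \<open>Away from the vertex the ratio of the coordinates determines the ray.\<close>
  have z_ray_iff: "z n k \<in> fan_ray m \<longleftrightarrow> m = Suc n" if "m \<ge> 1" for n k m
  proof
    assume "z n k \<in> fan_ray m"
    then obtain i where "i \<ge> 1" "1 / real (Suc k) = 1 / real i"
      "1 / (real (Suc k) * real (Suc n)) = 1 / (real i * real m)"
      by (auto simp: fan_ray_def z_def simp del: of_nat_Suc)
    then show "m = Suc n" using that by (simp del: of_nat_Suc)
  qed (use z_ray in simp)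
  have zS: "z n k \<in> topspace ?S" for n k
    using z_ray[of n k] unfolding topspace_Frechet_Urysohn_fan by auto
  have zero: "(0, 0) \<in> topspace ?S"
    unfolding topspace_Frechet_Urysohn_fan fan_ray_def by auto
  obtain f g where fg: "homeomorphic_maps ?S (subtopology X B) f g"
    using B(2) homeomorphic_space_sym unfolding homeomorphic_space_def by blast
  have f: "continuous_map ?S (subtopology X B) f"
    and g: "continuous_map (subtopology X B) ?S g"
    and gf: "\<And>u. u \<in> topspace ?S \<Longrightarrow> g (f u) = u"
    using fg unfolding homeomorphic_maps_def by auto
  have fX: "f u \<in> topspace X" "f u \<in> B" if "u \<in> topspace ?S" for u
    using continuous_map_image_subset_topspace[OF f] that by auto
  show ?thesis
  proof (rule that[of "f (0, 0)" "\<lambda>n k. f (z n k)"])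
    show "f (0, 0) \<in> topspace X" "f (z n k) \<in> topspace X" for n k using fX zS zero by auto
  next
    fix n
    have "(\<lambda>k. 1 / real (Suc k)) \<longlonglongrightarrow> 0"
      by (rule LIMSEQ_Suc) (rule lim_1_over_n)
    moreover from tendsto_mult[OF this tendsto_const[of "1 / real (Suc n)"]]
    have "(\<lambda>k. 1 / (real (Suc k) * real (Suc n))) \<longlonglongrightarrow> 0" by simp
    ultimately have lim: "z n \<longlonglongrightarrow> (0, 0)" unfolding z_def[abs_def] by (rule tendsto_Pair)
    have "limitin ?S (z n) (0, 0) sequentially"
      unfolding limitin_def
    proof (intro conjI allI impI zero)
      fix V assume V: "openin ?S V \<and> (0, 0) \<in> V"
      then have "openin (top_of_set (fan_ray (Suc n))) (V \<inter> fan_ray (Suc n))"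
        by (simp add: openin_Frechet_Urysohn_fan)
      then obtain T where T: "open T" "V \<inter> fan_ray (Suc n) = fan_ray (Suc n) \<inter> T"
        unfolding openin_open by blast
      have "(0, 0) \<in> T" using T(2) V by (auto simp: fan_ray_def)
      then show "\<forall>\<^sub>F k in sequentially. z n k \<in> V"
        using topological_tendstoD[OF lim T(1)] z_ray T(2) by (auto elim!: eventually_mono)
    qed
    from continuous_map_limit[OF continuous_map_into_fulltopology[OF f] this]
    show "limitin X (\<lambda>k. f (z n k)) (f (0, 0)) sequentially" by (simp add: o_def)
  next
    fix r \<kappa> :: "nat \<Rightarrow> nat" and x assume r: "strict_mono r"
    show "\<not> limitin X (\<lambda>j. f (z (r j) (\<kappa> j))) x sequentially"
    proof
      assume lim: "limitin X (\<lambda>j. f (z (r j) (\<kappa> j))) x sequentially"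
      have "x \<in> B" using limitin_closedin[OF lim B(1)] fX zS by simp
      then have lim_B: "limitin (subtopology X B) (\<lambda>j. f (z (r j) (\<kappa> j))) x sequentially"
        using lim fX zS by (simp add: limitin_subtopology)
      have lim_z: "limitin ?S (\<lambda>j. z (r j) (\<kappa> j)) (g x) sequentially"
        using continuous_map_limit[OF g lim_B] by (simp add: o_def gf[OF zS])
      \<comment> \<open>Sparing \<open>g x\<close> keeps the limit inside \<open>V\<close>. Ray
        \<open>m\<close> contains a term only if \<open>r j = m - 1\<close>, which holds for at most
        one \<open>j\<close>.\<close>
      define V where "V = topspace ?S - (range (\<lambda>j. z (r j) (\<kappa> j)) - {g x})"
      have "openin ?S V"
        unfolding openin_Frechet_Urysohn_fan
      proof (intro conjI allI impI)
        fix m :: nat assume m: "m \<ge> 1"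
        let ?E = "(range (\<lambda>j. z (r j) (\<kappa> j)) - {g x}) \<inter> fan_ray m"
        have "?E \<subseteq> (\<lambda>j. z (r j) (\<kappa> j)) ` (r -` {m - 1})"
          using z_ray_iff[OF m] by auto
        moreover have "finite (r -` {m - 1})"
          using r by (intro finite_vimageI strict_mono_imp_inj_on) auto
        ultimately have "finite ?E" by (meson finite_imageI finite_subset)
        then have "openin (top_of_set (fan_ray m)) (fan_ray m - ?E)"
          by (intro openin_diff) (auto intro: finite_imp_closed closed_subset)
        moreover have "V \<inter> fan_ray m = fan_ray m - ?E"
          using m by (auto simp: V_def topspace_Frechet_Urysohn_fan)
        ultimately show "openin (top_of_set (fan_ray m)) (V \<inter> fan_ray m)" by simp
      qed (auto simp: V_def topspace_Frechet_Urysohn_fan)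
      moreover have "g x \<in> V" using limitin_topspace[OF lim_z] by (simp add: V_def)
      ultimately have "\<forall>\<^sub>F j in sequentially. z (r j) (\<kappa> j) \<in> V"
        using limitinD[OF lim_z] by blast
      \<comment> \<open>A term lying in \<open>V\<close> can only be \<open>g x\<close>, so two
        consecutive terms on different rays coincide.\<close>
      then obtain J where J: "\<And>j. j \<ge> J \<Longrightarrow> z (r j) (\<kappa> j) = g x"
        by (auto simp: V_def eventually_sequentially)
      then have "z (r J) (\<kappa> J) = z (r (Suc J)) (\<kappa> (Suc J))" by simp
      then have "Suc (r J) = Suc (r (Suc J))"
        using z_ray_iff[of "Suc (r (Suc J))" "r J" "\<kappa> J"] z_ray by simp
      then show False using r by (metis Suc_inject lessI less_irrefl strict_mono_less)
    qed
  qed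
qed

section \<open>Lops containing closed copies of both fans\<close>

theorem corollary4p4:
  fixes X :: "'a topology" and mul :: "'a \<Rightarrow> 'a \<Rightarrow> 'a"
  assumes "regular_space X" and "t1_space X"
    and "topological_lop X mul"
    and "countable_cs_star_character X"
    and "\<exists>A. closedin X A \<and> subtopology X A homeomorphic_space metric_fan"
    and "\<exists>B. closedin X B \<and> subtopology X B homeomorphic_space Frechet_Urysohn_fan"
  shows "\<not> sequential_space X"
proof -
  obtain ldiv e where "top_lop X mul ldiv e"
    using assms(3) by (rule topological_lop_imp_top_lop)
  then interpret top_lop X mul ldiv e .
  obtain \<N> where \<N>: "countable \<N>" "cs_star_network_at X e \<N>"
    using assms(4) e_in unfolding countable_cs_star_character_def by blast
  obtain A B where A: "closedin X A" "subtopology X A homeomorphic_space metric_fan"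
    and B: "closedin X B" "subtopology X B homeomorphic_space Frechet_Urysohn_fan"
    using assms(5,6) by blast
  obtain p a where a: "p \<in> topspace X" "\<And>n m. a n m \<in> topspace X"
    "\<And>n m. a n m \<noteq> p"
    "\<And>U. \<lbrakk>openin X U; p \<in> U\<rbrakk> \<Longrightarrow> \<exists>n0. \<forall>n\<ge>n0. \<forall>m::nat. a n m \<in> U"
    "\<And>(n::nat) x. x \<in> topspace X \<Longrightarrow> \<exists>U. openin X U \<and> x \<in> U \<and> finite {m. a n m \<in> U}"
    by (fact closed_metric_fan_double_sequence[OF A])
  obtain q and b :: "nat \<Rightarrow> nat \<Rightarrow> 'a" where b: "q \<in> topspace X" "\<And>n k. b n k \<in> topspace X"
    "\<And>n. limitin X (b n) q sequentially"
    "\<And>r \<kappa> x. strict_mono r \<Longrightarrow> \<not> limitin X (\<lambda>j. b (r j) (\<kappa> j)) x sequentially"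
    by (fact closed_Frechet_Urysohn_fan_double_sequence[OF B])
  show ?thesis
    using assms(1,2) \<N> a(1) b(1) a(2) b(2) a(3,4,5) b(3,4)
    by (rule not_sequential_if_double_sequences)
qed

end
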